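(* Let $k$ be a positive integer and let $d$ be a real number with $1 \leq d < k$. Let $\mathcal{H}$ be a $k$-uniform hypergraph with degree bound $d$, and suppose $|\mathcal{H}| = qd + r$ with nonnegative integers $q$ and $r$, where $r < d$. Then $$|\sigma(\mathcal{H})| \geq (qd + r)k - q\binom{d}{2} - \binom{r}{2}.$$
   Context: A $k$-uniform hypergraph on $[n]=\{1,\ldots,n\}$ ($n$ a positive integer) is a family $\mathcal{H} \subset \binom{[n]}{k}$ of $k$-element subsets of $[n]$, called hyperedges; $|\mathcal{H}|$ is the number of hyperedges. The shadow of $\mathcal{H}$ is $\sigma(\mathcal{H}) = \{S \in \binom{[n]}{k-1} : \exists H \in \mathcal{H},\ S \subset H\}$. The maximum degree is $\Delta(\mathcal{H}) = \max_{v \in [n]} |\{H \in \mathcal{H} : v \in H\}|$, and a degree bound of $\mathcal{H}$ is any real number $d$ with $\Delta(\mathcal{H}) \leq d$. For a real number $x$ and positive integer $j$, $\binom{x}{j} = \frac{x(x-1)\cdots(x-j+1)}{j!}$; in particular $\binom{x}{2} = x(x-1)/2$. *)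

theory Defs
  imports Complex_Main "HOL-Library.Ramsey"
begin

text \<open>The library's \<open>nsets A k\<close>, written \<open>[A]\<^bsup>k\<^esup>\<close>, is the family of \<open>k\<close>-element subsets of \<open>A\<close>.\<close>

definition uniform_hypergraph :: "nat \<Rightarrow> nat \<Rightarrow> nat set set \<Rightarrow> bool" where
  "uniform_hypergraph n k H \<longleftrightarrow> H \<subseteq> [{1..n}]\<^bsup>k\<^esup>"

text \<open>Only used for \<open>k \<ge> 1\<close>, so the truncated subtraction is harmless.\<close>

definition shadow :: "nat \<Rightarrow> nat \<Rightarrow> nat set set \<Rightarrow> nat set set" where
  "shadow n k H = {S \<in> [{1..n}]\<^bsup>(k - 1)\<^esup>. \<exists>E\<in>H. S \<subseteq> E}"

definition degree :: "nat set set \<Rightarrow> nat \<Rightarrow> nat" where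
  "degree H v = card {E \<in> H. v \<in> E}"

text \<open>The maximum is over a nonempty set only for \<open>n \<ge> 1\<close>.\<close>

definition max_degree :: "nat \<Rightarrow> nat set set \<Rightarrow> nat" where
  "max_degree n H = Max (degree H ` {1..n})"

definition degree_bound :: "nat \<Rightarrow> nat set set \<Rightarrow> real \<Rightarrow> bool" where
  "degree_bound n H d \<longleftrightarrow> real (max_degree n H) \<le> d"

end

theory Submission
  imports Defs
begin

text \<open>Join two edges when they share a \<open>(k - 1)\<close>-set. Edges in different connected components of
this graph have no common shadow element, so the shadow splits over the components.

The degree bound makes every component small. Moving along an edge of the graph loses at most one
vertex, so a connected family of \<open>a\<close> edges has at least \<open>k + 1 - a\<close> vertices in common. If a component
had more than \<open>d\<close> edges, it would contain a connected family of \<open>\<lfloor>d\<rfloor> + 1 \<le> k\<close> edges; some vertex would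
lie in all of them and have degree above \<open>d\<close>. Hence each component has at most \<open>d\<close> edges. This argument
is \<open>tight_cluster_extend\<close>, and \<open>shadow_isolated_cluster_exists\<close> deduces that a family with isolated
shadow can be split off. The proof works directly with the inequality for the common vertices, which
makes a notion of connectedness unnecessary.

Two distinct \<open>k\<close>-sets share at most one \<open>(k - 1)\<close>-set, so \<open>a\<close> edges have a shadow of size at
least \<open>a k - a (a - 1) / 2\<close>. With \<open>a\<^sub>1 + a\<^sub>2 + \<dots> = q d + r\<close> fixed, the sum of these bounds depends only on the
sum of the \<open>a\<^sub>i\<^sup>2\<close>. By convexity, under \<open>0 \<le> a\<^sub>i \<le> d\<close> that sum is largest when all the parts but one are
\<open>0\<close> or \<open>d\<close>, that is, at most \<open>q d\<^sup>2 + r\<^sup>2\<close>; the exchange step is \<open>sum_squares_carry\<close>.\<close>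

lemma uniform_hypergraph_finite:
  "uniform_hypergraph n k H \<Longrightarrow> finite H"
  unfolding uniform_hypergraph_def by (meson finite_atLeastAtMost finite_imp_finite_nsets finite_subset)

lemma uniform_hypergraph_subset:
  "uniform_hypergraph n k H \<Longrightarrow> G \<subseteq> H \<Longrightarrow> uniform_hypergraph n k G"
  unfolding uniform_hypergraph_def by blast

lemma finite_shadow: "finite (shadow n k H)"
proof -
  have "shadow n k H \<subseteq> [{1..n}]\<^bsup>(k - 1)\<^esup>"
    unfolding shadow_def by blast
  then show ?thesis
    by (meson finite_atLeastAtMost finite_imp_finite_nsets finite_subset)
qed

lemma shadow_Un: "shadow n k (G \<union> H) = shadow n k G \<union> shadow n k H"
  unfolding shadow_def by blast

lemma shadow_edge:
  "E \<in> [{1..n}]\<^bsup>k\<^esup> \<Longrightarrow> shadow n k {E} = [E]\<^bsup>(k - 1)\<^esup>"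
  unfolding shadow_def nsets_def by auto

lemma card_shadow_edge:
  assumes "E \<in> [{1..n}]\<^bsup>k\<^esup>" "1 \<le> k"
  shows "card (shadow n k {E}) = k"
proof -
  have "finite E" "card E = k"
    using assms by (auto simp: nsets_def)
  then have "card (shadow n k {E}) = k choose (k - 1)"
    by (simp add: shadow_edge[OF assms(1)])
  then show ?thesis
    using assms(2) by (metis binomial_symmetric choose_one diff_diff_cancel diff_le_self)
qed

lemma shadow_inter_distinct_edges:
  assumes "E \<in> [{1..n}]\<^bsup>k\<^esup>" "F \<in> [{1..n}]\<^bsup>k\<^esup>" "E \<noteq> F"
  shows "shadow n k {E} \<inter> shadow n k {F} \<subseteq> {E \<inter> F}"
proof
  fix S assume "S \<in> shadow n k {E} \<inter> shadow n k {F}"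
  then have S: "S \<subseteq> E \<inter> F" "card S = k - 1"
    by (auto simp: shadow_def nsets_def)
  have fin: "finite E" "finite F" "card E = k" "card F = k"
    using assms by (auto simp: nsets_def)
  have "\<not> E \<subseteq> F"
    using fin assms(3) card_subset_eq[of F E] by auto
  then have "card (E \<inter> F) < k"
    using fin psubset_card_mono[of E "E \<inter> F"] by auto
  then have "S = E \<inter> F"
    using S fin card_seteq[of "E \<inter> F" S] by auto
  then show "S \<in> {E \<inter> F}"
    by simp
qed

text \<open>A new edge has \<open>k\<close> shadow elements, and each older edge accounts for at most one of those
already present.\<close>

lemma card_shadow_insert:
  assumes "uniform_hypergraph n k (insert E G)" "1 \<le> k" "E \<notin> G"
  shows "card (shadow n k G) + k \<le> card (shadow n k (insert E G)) + card G"
proof -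
  have finG: "finite G"
    using uniform_hypergraph_finite[OF assms(1)] by simp
  have edge: "F \<in> [{1..n}]\<^bsup>k\<^esup>" if "F \<in> insert E G" for F
    using assms(1) that unfolding uniform_hypergraph_def by blast
  have "shadow n k {E} \<inter> shadow n k G = (\<Union>F\<in>G. shadow n k {E} \<inter> shadow n k {F})"
    unfolding shadow_def by blast
  also have "\<dots> \<subseteq> (\<lambda>F. E \<inter> F) ` G"
  proof -
    have "shadow n k {E} \<inter> shadow n k {F} \<subseteq> {E \<inter> F}" if "F \<in> G" for F
      using that assms(3) by (intro shadow_inter_distinct_edges edge) auto
    then show ?thesis
      by blast
  qed
  finally have "card (shadow n k {E} \<inter> shadow n k G) \<le> card G"
    using finG surj_card_le by blast
  moreover have "card (shadow n k {E}) + card (shadow n k G)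
      = card (shadow n k (insert E G)) + card (shadow n k {E} \<inter> shadow n k G)"
    using card_Un_Int[OF finite_shadow finite_shadow] shadow_Un[of n k "{E}" G] by simp
  ultimately show ?thesis
    using card_shadow_edge[OF edge[of E] assms(2)] by simp
qed

text \<open>Adding the edges one at a time loses at most \<open>0 + 1 + \<dots> + (a - 1)\<close> of the \<open>k a\<close> shadow elements,
where \<open>a\<close> is the number of edges. The bound \<open>k a - a (a - 1) / 2\<close> is doubled and rearranged to avoid
subtraction and division on the naturals.\<close>

lemma card_shadow_lower_bound:
  assumes "finite G" "uniform_hypergraph n k G" "1 \<le> k"
  shows "(2 * k + 1) * card G \<le> 2 * card (shadow n k G) + (card G)\<^sup>2"
  using assms(1,2)
proof (induction G rule: finite_induct)
  case empty
  then show ?case by simp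
next
  case (insert E G)
  have "uniform_hypergraph n k G"
    using insert.prems by (rule uniform_hypergraph_subset) blast
  then have IH: "(2 * k + 1) * card G \<le> 2 * card (shadow n k G) + (card G)\<^sup>2"
    by (rule insert.IH)
  have "card (shadow n k G) + k \<le> card (shadow n k (insert E G)) + card G"
    by (rule card_shadow_insert[OF insert.prems assms(3) insert.hyps(2)])
  with IH show ?case
    using insert.hyps by (simp add: power2_eq_square algebra_simps)
qed

text \<open>The degree bound enters here. The new edge \<open>E\<close> misses at most one vertex of \<open>F\<close>, hence at most one
vertex common to all of \<open>C\<close>, so the number of common vertices drops by at most one. Since
\<open>card C \<le> d < k\<close>, the enlarged family has at most \<open>k\<close> edges and so still has a common vertex; the
degree of that vertex keeps the enlarged family within \<open>d\<close> edges.\<close>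

lemma tight_cluster_extend:
  assumes H: "uniform_hypergraph n k H" and deg: "\<And>v. real (degree H v) \<le> d" and "d < real k"
    and C: "C \<subseteq> H" "C \<noteq> {}" "k + 1 \<le> card (\<Inter>C) + card C" "real (card C) \<le> d"
    and E: "E \<in> H - C" and F: "F \<in> C" and S: "S \<subseteq> E" "S \<subseteq> F" "card S = k - 1"
  shows "k + 1 \<le> card (\<Inter>(insert E C)) + card (insert E C)" "real (card (insert E C)) \<le> d"
proof -
  have finH: "finite H"
    by (rule uniform_hypergraph_finite[OF H])
  then have finC: "finite C"
    using C(1) finite_subset by blast
  have FH: "finite F" "card F = k"
    using H F C(1) by (auto simp: uniform_hypergraph_def nsets_def)
  have finI: "finite (\<Inter>C)"
    using F FH(1) by (meson Inter_lower finite_subset)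
  have "card (F - E) \<le> card (F - S)"
    using S FH by (intro card_mono) auto
  also have "\<dots> \<le> 1"
    using S FH by (simp add: card_Diff_subset finite_subset)
  finally have FE: "card (F - E) \<le> 1" .
  have "card (\<Inter>C) \<le> card (\<Inter>(insert E C) \<union> (F - E))"
    using F FH finI by (intro card_mono) (auto simp: finite_subset)
  also have "\<dots> \<le> card (\<Inter>(insert E C)) + card (F - E)"
    by (rule card_Un_le)
  finally have "card (\<Inter>C) \<le> card (\<Inter>(insert E C)) + 1"
    using FE by simp
  moreover have cardI: "card (insert E C) = card C + 1"
    using E finC by simp
  ultimately show tight: "k + 1 \<le> card (\<Inter>(insert E C)) + card (insert E C)"
    using C(3) by simp
  have "card C < k"
    using C(4) assms(3) by simp
  then have "card (\<Inter>(insert E C)) \<noteq> 0"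
    using tight cardI by simp
  then obtain v where v: "v \<in> \<Inter>(insert E C)"
    by (metis card.empty ex_in_conv)
  have "card (insert E C) \<le> degree H v"
    unfolding degree_def using v E C(1) finH by (intro card_mono) auto
  then show "real (card (insert E C)) \<le> d"
    using deg[of v] by simp
qed

text \<open>A single edge has \<open>k\<close> common vertices, so families to which \<open>tight_cluster_extend\<close> applies exist.
A maximal one cannot share a shadow element with an outside edge, which could otherwise be added.\<close>

lemma shadow_isolated_cluster_exists:
  assumes H: "uniform_hypergraph n k H" and deg: "\<And>v. real (degree H v) \<le> d"
    and "1 \<le> d" "d < real k" "H \<noteq> {}"
  obtains C where "C \<subseteq> H" "C \<noteq> {}" "real (card C) \<le> d" "shadow n k C \<inter> shadow n k (H - C) = {}"
proof -
  define tight where "tight C \<longleftrightarrow> C \<subseteq> H \<and> C \<noteq> {} \<and> k + 1 \<le> card (\<Inter>C) + card C \<and> real (card C) \<le> d"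
    for C
  have finH: "finite H"
    by (rule uniform_hypergraph_finite[OF H])
  obtain E0 where E0: "E0 \<in> H"
    using assms(5) by blast
  then have "card E0 = k"
    using H by (auto simp: uniform_hypergraph_def nsets_def)
  then have "tight {E0}"
    using E0 assms(3) by (simp add: tight_def)
  moreover have "finite (Collect tight)"
    using finH by (rule_tac finite_subset[of _ "Pow H"]) (auto simp: tight_def)
  ultimately obtain C where C: "tight C" and maxC: "\<And>B. tight B \<Longrightarrow> C \<subseteq> B \<Longrightarrow> C = B"
    using finite_has_maximal[of "Collect tight"] by blast
  have "shadow n k C \<inter> shadow n k (H - C) = {}"
  proof (rule ccontr)
    assume "shadow n k C \<inter> shadow n k (H - C) \<noteq> {}"
    then obtain S E F where "F \<in> C" "E \<in> H - C" "S \<subseteq> E" "S \<subseteq> F" "card S = k - 1"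
      unfolding shadow_def nsets_def by blast
    then have "tight (insert E C)"
      using tight_cluster_extend[OF H deg assms(4), of C E F S] C by (auto simp: tight_def)
    then show False
      using maxC[of "insert E C"] \<open>E \<in> H - C\<close> by blast
  qed
  then show thesis
    using C that by (auto simp: tight_def)
qed

text \<open>Adding a part \<open>a\<close> to the remainder \<open>r\<close> either stays below \<open>d\<close> or completes a full block of
size \<open>d\<close>. In the second case \<open>r\<close> and \<open>a\<close> are replaced by \<open>d\<close> and \<open>r + a - d\<close>, which have the same sum
but are further apart: the sum of squares grows by \<open>2 (d - r) (d - a)\<close>.\<close>

lemma sum_squares_carry:
  fixes d a r :: real
  assumes "0 \<le> r" "r < d" "0 \<le> a" "a \<le> d"
  obtains q' :: nat and r' where "0 \<le> r'" "r' < d"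
    "real q * d + r + a = real q' * d + r'"
    "real q * d\<^sup>2 + r\<^sup>2 + a\<^sup>2 \<le> real q' * d\<^sup>2 + r'\<^sup>2"
proof (cases "r + a < d")
  case True
  have "0 \<le> r * a"
    using assms by simp
  then show thesis
    using True assms by (intro that[of "r + a" q]) (auto simp: power2_eq_square algebra_simps)
next
  case False
  have "0 \<le> (d - r) * (d - a)"
    using assms by simp
  then show thesis
    using False assms by (intro that[of "r + a - d" "Suc q"]) (auto simp: power2_eq_square algebra_simps)
qed

text \<open>The induction splits off an isolated family and merges its size into the quotient and remainder
of the rest. Sizes of subfamilies need not have an integral remainder modulo the real number \<open>d\<close>, so
\<open>r\<close> is real here. Because \<open>q d + r\<close> is the number of edges, the linear terms of \<open>q d (d - 1) / 2\<close> and
\<open>r (r - 1) / 2\<close> add up to a multiple of that number, and only the squares remain in the bound.\<close>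

lemma shadow_bound_some_quotient:
  fixes d :: real
  assumes "finite H" "uniform_hypergraph n k H" "\<And>v. real (degree H v) \<le> d"
    and "1 \<le> d" "d < real k"
  shows "\<exists>(q::nat) r. 0 \<le> r \<and> r < d \<and> real (card H) = real q * d + r
    \<and> (2 * real k + 1) * real (card H) \<le> 2 * real (card (shadow n k H)) + (real q * d\<^sup>2 + r\<^sup>2)"
  using assms(1-3)
proof (induction H rule: finite_psubset_induct)
  case (psubset H)
  show ?case
  proof (cases "H = {}")
    case True
    then show ?thesis
      using assms(4) by (intro exI[of _ 0]) simp
  next
    case False
    obtain C where C: "C \<subseteq> H" "C \<noteq> {}" "real (card C) \<le> d"
      and disj: "shadow n k C \<inter> shadow n k (H - C) = {}"
      using shadow_isolated_cluster_exists[OF psubset.prems assms(4,5) False] by blast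
    have "real (degree (H - C) v) \<le> d" for v
    proof -
      have "degree (H - C) v \<le> degree H v"
        unfolding degree_def using psubset.hyps by (intro card_mono) auto
      then show ?thesis
        using psubset.prems(2)[of v] by simp
    qed
    then obtain q :: nat and r where r: "0 \<le> r" "r < d" and
      qr: "real (card (H - C)) = real q * d + r" and
      rest: "(2 * real k + 1) * real (card (H - C))
        \<le> 2 * real (card (shadow n k (H - C))) + (real q * d\<^sup>2 + r\<^sup>2)"
      using psubset.IH[of "H - C"] C uniform_hypergraph_subset[OF psubset.prems(1), of "H - C"]
      by blast
    have finC: "finite C"
      using C(1) psubset.hyps finite_subset by blast
    have "(2 * k + 1) * card C \<le> 2 * card (shadow n k C) + (card C)\<^sup>2"
      using finC uniform_hypergraph_subset[OF psubset.prems(1) C(1)] assms(4,5)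
      by (intro card_shadow_lower_bound) auto
    then have "real ((2 * k + 1) * card C) \<le> real (2 * card (shadow n k C) + (card C)\<^sup>2)"
      by (rule of_nat_mono)
    then have cluster: "(2 * real k + 1) * real (card C) \<le> 2 * real (card (shadow n k C)) + (real (card C))\<^sup>2"
      by (simp add: algebra_simps)
    have cardH: "real (card H) = real (card (H - C)) + real (card C)"
      using C(1) psubset.hyps finC by (simp add: card_Diff_subset card_mono)
    have "shadow n k H = shadow n k C \<union> shadow n k (H - C)"
      using shadow_Un[of n k C "H - C"] C(1) by (simp add: Un_absorb1)
    then have "card (shadow n k H) = card (shadow n k C) + card (shadow n k (H - C))"
      using disj by (simp add: card_Un_disjoint finite_shadow)
    then have cardS: "real (card (shadow n k H)) = real (card (shadow n k C)) + real (card (shadow n k (H - C)))"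
      by simp
    obtain q' :: nat and r' where "0 \<le> r'" "r' < d"
      "real q * d + r + real (card C) = real q' * d + r'"
      "real q * d\<^sup>2 + r\<^sup>2 + (real (card C))\<^sup>2 \<le> real q' * d\<^sup>2 + r'\<^sup>2"
      using sum_squares_carry[OF r, of "real (card C)" q] C(3) by (metis of_nat_0_le_iff)
    moreover have "(2 * real k + 1) * real (card H)
        = (2 * real k + 1) * real (card (H - C)) + (2 * real k + 1) * real (card C)"
      by (simp add: cardH distrib_left)
    ultimately show ?thesis
      using rest cluster cardH cardS qr by (intro exI[of _ q'] exI[of _ r'] conjI) linarith+
  qed
qed

lemma quotient_unique:
  fixes d r r' :: real and q q' :: nat
  assumes "real q * d + r = real q' * d + r'" "0 \<le> r" "r < d" "0 \<le> r'" "r' < d"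
  shows "q = q'"
proof -
  have "\<lfloor>(real p * d + s) / d\<rfloor> = int p" if "0 \<le> s" "s < d" for p and s :: real
    using that by (intro floor_unique) (auto simp: field_simps)
  then show ?thesis
    by (metis assms of_nat_eq_iff)
qed

lemma gchoose_two_real: "(x::real) gchoose 2 = x * (x - 1) / 2"
  by (simp add: gbinomial_prod_rev numeral_2_eq_2)

theorem theorem1p2:
  fixes n k q r :: nat and d :: real and H :: "nat set set"
  assumes "1 \<le> n" and "1 \<le> k"
    and "1 \<le> d" and "d < real k"
    and "uniform_hypergraph n k H"
    and "degree_bound n H d"
    and "real (card H) = real q * d + real r"
    and "real r < d"
  shows "real (card (shadow n k H))
           \<ge> (real q * d + real r) * real k - real q * (d gchoose 2) - (real r gchoose 2)"
proof -
  have deg: "real (degree H v) \<le> d" for v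
  proof (cases "v \<in> {1..n}")
    case True
    then have "degree H v \<le> max_degree n H"
      unfolding max_degree_def by simp
    then show ?thesis
      using assms(6) unfolding degree_bound_def by simp
  next
    case False
    moreover have "E \<subseteq> {1..n}" if "E \<in> H" for E
      using assms(5) that unfolding uniform_hypergraph_def nsets_def by blast
    ultimately have "{E \<in> H. v \<in> E} = {}"
      by blast
    then have "degree H v = 0"
      by (simp only: degree_def card.empty)
    then show ?thesis
      using assms(3) by simp
  qed
  obtain q' :: nat and r' where r': "0 \<le> r'" "r' < d" and
    qr': "real (card H) = real q' * d + r'" and
    bound: "(2 * real k + 1) * real (card H) \<le> 2 * real (card (shadow n k H)) + (real q' * d\<^sup>2 + r'\<^sup>2)"
    using shadow_bound_some_quotient[OF uniform_hypergraph_finite[OF assms(5)] assms(5) deg assms(3,4)]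
    by blast
  have "q' = q"
    using quotient_unique[of q' d r' q "real r"] r' qr' assms(7,8) by simp
  then have "r' = real r"
    using qr' assms(7) by simp
  with bound \<open>q' = q\<close> show ?thesis
    unfolding gchoose_two_real assms(7) by (simp add: power2_eq_square field_simps)
qed

end
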